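(* Let $h\ge 2$ be an integer. Then $D_0^{(h,2)}=1$ and, for every $n\ge 1$, $$D_n^{(h,2)}=\sum_{j=1}^{\lceil (h+1)/2\rceil}D_{n-j}^{(h,2)}\,\frac{3j-h-2}{j}\binom{h-j+1}{j-1}(-1)^j-\frac{3n-h-1}{n}\binom{h-n}{n-1}(-1)^n,$$ where $D_\ell^{(h,2)}=0$ whenever $\ell<0$.
   Context: A Dyck path of semilength $n$ is a lattice path from $(0,0)$ to $(2n,0)$ with up steps $U=(1,1)$ and down steps $D=(1,-1)$ that never goes below the $x$-axis. Its height is the maximum ordinate it reaches. A valley is an occurrence of consecutive steps $DU$; the height of a valley is the ordinate of the endpoint of its $D$ step. For $n\ge 0$, $D_n^{(h,2)}$ denotes the number of Dyck paths of semilength $n$ with height at most $h$ and with no valley at height $h-1$ (the empty path is counted for $n=0$). Convention: $\binom{a}{b}=0$ if $a<0$ or if $b>a\ge 0$. *)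

theory Defs
  imports Complex_Main
begin

datatype step = Up | Down

fun rise :: "step \<Rightarrow> int" where
  "rise Up = 1"
| "rise Down = -1"

(* A path from (0,0) is the list of its steps; its i-th lattice point is (i, ordinate p i). *)
definition ordinate :: "step list \<Rightarrow> nat \<Rightarrow> int" where
  "ordinate p i = sum_list (map rise (take i p))"

definition dyck_path :: "nat \<Rightarrow> step list \<Rightarrow> bool" where
  "dyck_path n p \<longleftrightarrow>
     length p = 2 * n \<and> ordinate p (2 * n) = 0 \<and> (\<forall>i\<le>2 * n. ordinate p i \<ge> 0)"

definition path_height :: "step list \<Rightarrow> int" where
  "path_height p = Max (ordinate p ` {..length p})"

definition valley_heights :: "step list \<Rightarrow> int set" where
  "valley_heights p =
     {ordinate p (Suc i) | i. Suc i < length p \<and> p ! i = Down \<and> p ! Suc i = Up}"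

definition restricted_dyck_paths :: "nat \<Rightarrow> nat \<Rightarrow> step list set" where
  "restricted_dyck_paths h n =
     {p. dyck_path n p \<and> path_height p \<le> int h \<and> int h - 1 \<notin> valley_heights p}"

(* The number D_l^(h,2), extended by 0 to negative l. *)
definition dyck_num :: "nat \<Rightarrow> int \<Rightarrow> nat" where
  "dyck_num h l = (if l < 0 then 0 else card (restricted_dyck_paths h (nat l)))"

(* 0 for a negative upper index, unlike gchoose; b > a >= 0 already gives 0 in choose.
   The value for b < 0 is immaterial: only b >= 0 is used. *)
definition binom :: "int \<Rightarrow> int \<Rightarrow> nat" where
  "binom a b = (if a < 0 \<or> b < 0 then 0 else nat a choose nat b)"

end

theory Submission
  imports Defs "HOL-Computational_Algebra.Formal_Power_Series"
begin

text \<open>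
The last part of a Dyck path, seen from a point at height \<open>k\<close>, is a word that descends from \<open>k\<close> to the
axis. Let \<open>G\<^sub>k\<close> be the generating function of those words that stay at or below height \<open>h\<close> and have
no valley at height \<open>h - 1\<close>, where the variable \<open>x\<close> marks up steps only; then \<open>G\<^sub>0\<close> counts the
restricted Dyck paths by semilength. Reading off the first step gives \<open>G\<^sub>k = [k = 0] + x G\<^bsub>k+1\<^esub> +
G\<^bsub>k-1\<^esub>\<close> for \<open>k < h\<close>, where \<open>G\<^bsub>-1\<^esub> = 0\<close>, and the forbidden valley makes a path at the ceiling go down
twice, so that \<open>G\<^sub>h = G\<^bsub>h-2\<^esub>\<close>.

This finite linear system is solved by elimination from the ceiling downwards
(\<open>continuant_descent_gf\<close>). With \<open>A\<^sub>0 = 1 + x\<close>, \<open>A\<^sub>1 = 1\<close> and \<open>A\<^bsub>i+2\<^esub> = A\<^bsub>i+1\<^esub> - x A\<^sub>i\<close> it yields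
\<open>A\<^sub>i G\<^bsub>h-i\<^esub> = A\<^bsub>i-1\<^esub> G\<^bsub>h-i-1\<^esub>\<close>, and at the axis \<open>A\<^sub>h G\<^sub>0 = A\<^bsub>h-1\<^esub>\<close> (\<open>continuant_dyck_gf\<close>). A Pascal-type
recurrence (\<open>binomial_weight_rec\<close>) identifies the coefficient of \<open>x\<^sup>j\<close> in \<open>A\<^sub>i\<close>, for \<open>j \<ge> 1\<close>, as
\<open>-(-1)\<^sup>j\<close> times the weight \<open>(3j - i - 2)/j\<close> times the binomial coefficient of \<open>i - j + 1\<close> over
\<open>j - 1\<close>. Comparing coefficients of \<open>x\<^sup>n\<close> in \<open>A\<^sub>h G\<^sub>0 = A\<^bsub>h-1\<^esub>\<close> is the claim: \<open>A\<^sub>h\<close> provides the sum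
and \<open>A\<^bsub>h-1\<^esub>\<close> the last term.
\<close>

section \<open>Paths as words that descend to the axis\<close>

text \<open>
The last conjunct of the third equation excludes the valleys at height \<open>h - 1\<close>: these are exactly the
occurrences of \<open>Down\<close>, \<open>Up\<close> that start at height \<open>h\<close>.
\<close>

fun admissible :: "nat \<Rightarrow> nat \<Rightarrow> step list \<Rightarrow> bool" where
  "admissible h k [] \<longleftrightarrow> k = 0"
| "admissible h k (Up # p) \<longleftrightarrow> k < h \<and> admissible h (Suc k) p"
| "admissible h k (Down # p) \<longleftrightarrow>
     0 < k \<and> admissible h (k - 1) p \<and> (k = h \<longrightarrow> (\<forall>q. p \<noteq> Up # q))"

lemma ordinate_0 [simp]: "ordinate p 0 = 0"
  by (simp add: ordinate_def)

lemma ordinate_Cons [simp]: "ordinate (s # p) (Suc i) = rise s + ordinate p i"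
  by (simp add: ordinate_def)

lemma all_le_Suc_iff: "(\<forall>i\<le>Suc n. P i) \<longleftrightarrow> P 0 \<and> (\<forall>i\<le>n. P (Suc i))"
  by (metis Suc_le_mono le0 not0_implies_Suc)

lemma ex_Suc_iff: "(\<exists>i. P i) \<longleftrightarrow> P 0 \<or> (\<exists>i. P (Suc i))"
  by (metis not0_implies_Suc)

lemma valley_heights_Nil [simp]: "valley_heights [] = {}"
  by (simp add: valley_heights_def)

text \<open>
Prepending a step shifts all valleys by its rise; the only new valley is one at the junction, whose
height is that of the endpoint of the prepended \<open>Down\<close>.
\<close>

lemma mem_valley_heights_Cons:
  "v \<in> valley_heights (s # p) \<longleftrightarrow>
     v - rise s \<in> valley_heights p \<or> (v = -1 \<and> s = Down \<and> (\<exists>q. p = Up # q))"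
proof -
  have "v \<in> valley_heights (s # p) \<longleftrightarrow>
      (\<exists>i. v = ordinate (s # p) (Suc i) \<and> Suc i < length (s # p) \<and>
           (s # p) ! i = Down \<and> (s # p) ! Suc i = Up)"
    by (auto simp: valley_heights_def)
  also have "\<dots> \<longleftrightarrow>
      (v = rise s \<and> p \<noteq> [] \<and> s = Down \<and> p ! 0 = Up) \<or>
      (\<exists>i. v = rise s + ordinate p (Suc i) \<and> Suc i < length p \<and> p ! i = Down \<and> p ! Suc i = Up)"
    by (subst ex_Suc_iff) simp
  also have "(\<exists>i. v = rise s + ordinate p (Suc i) \<and> Suc i < length p \<and> p ! i = Down \<and> p ! Suc i = Up)
      \<longleftrightarrow> v - rise s \<in> valley_heights p"
    by (auto simp: valley_heights_def algebra_simps)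
  also have "(v = rise s \<and> p \<noteq> [] \<and> s = Down \<and> p ! 0 = Up) \<longleftrightarrow> 
      (v = -1 \<and> s = Down \<and> (\<exists>q. p = Up # q))"
    by (cases p) auto
  finally show ?thesis by blast
qed

text \<open>
This links the stepwise description to the definitions by ordinates and valleys. The starting height
has to vary for the induction, so all heights are translated by \<open>k\<close>.
\<close>

lemma admissible_iff:
  assumes "k \<le> h"
  shows "admissible h k p \<longleftrightarrow>
    int k + ordinate p (length p) = 0 \<and>
    (\<forall>i\<le>length p. 0 \<le> int k + ordinate p i \<and> int k + ordinate p i \<le> int h) \<and>
    int h - 1 - int k \<notin> valley_heights p"
  using assms
proof (induction p arbitrary: k)
  case Nil
  then show ?case by auto
next
  case (Cons s p)
  show ?case
  proof (cases s)
    case Up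
    show ?thesis
    proof (cases "k < h")
      case True
      with Cons.IH[of "Suc k"] Up Cons.prems show ?thesis
        by (simp add: all_le_Suc_iff mem_valley_heights_Cons algebra_simps)
    next
      case False
      then have "\<not> (int k + ordinate (s # p) (Suc 0) \<le> int h)"
        using Up by simp
      with False Up show ?thesis
        by (auto simp: all_le_Suc_iff)
    qed
  next
    case Down
    show ?thesis
    proof (cases "0 < k")
      case True
      then have "int (k - 1) = int k - 1" by simp
      with True Cons.IH[of "k - 1"] Down Cons.prems show ?thesis
        by (auto simp: all_le_Suc_iff mem_valley_heights_Cons algebra_simps)
    next
      case False
      then have "\<not> (0 \<le> int k + ordinate (s # p) (Suc 0))"
        using Down by simp
      with False Down show ?thesis
        by (auto simp: all_le_Suc_iff)
    qed
  qed
qed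

lemma length_admissible: "admissible h k p \<Longrightarrow> length p = 2 * count_list p Up + k"
  by (induction h k p rule: admissible.induct) auto

text \<open>
Words are graded by their up steps, not by their length, because this makes the first-step equations
linear in \<open>x\<close>: down steps have weight 1, and no substitution \<open>x \<leadsto> x\<^sup>2\<close> occurs.
\<close>

definition descents :: "nat \<Rightarrow> nat \<Rightarrow> nat \<Rightarrow> step list set" where
  "descents h k u = {p. admissible h k p \<and> count_list p Up = u}"

lemma restricted_dyck_paths_eq: "restricted_dyck_paths h n = descents h 0 n"
proof -
  have "path_height p \<le> int h \<longleftrightarrow> (\<forall>i\<le>length p. ordinate p i \<le> int h)" for p
    unfolding path_height_def by (subst Max_le_iff) auto
  then have "p \<in> restricted_dyck_paths h n \<longleftrightarrow> length p = 2 * n \<and> admissible h 0 p" for p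
    unfolding restricted_dyck_paths_def dyck_path_def
    by (auto simp: admissible_iff)
  then show ?thesis
    using length_admissible[of h 0] by (fastforce simp: descents_def)
qed

lemma finite_descents: "finite (descents h k u)"
proof (rule finite_subset)
  show "descents h k u \<subseteq> {p. set p \<subseteq> {Up, Down} \<and> length p = 2 * u + k}"
  proof
    fix p
    assume "p \<in> descents h k u"
    moreover have "set p \<subseteq> {Up, Down}"
      using step.exhaust by blast
    ultimately show "p \<in> {p. set p \<subseteq> {Up, Down} \<and> length p = 2 * u + k}"
      using length_admissible[of h k p] by (simp add: descents_def)
  qed
qed (simp add: finite_lists_length_eq)

section \<open>Generating functions\<close>

definition descent_gf :: "nat \<Rightarrow> nat \<Rightarrow> real fps" where
  "descent_gf h k = Abs_fps (\<lambda>u. real (card (descents h k u)))"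

lemma descents_step:
  assumes "k < h"
  shows "descents h k u =
    (if k = 0 \<and> u = 0 then {[]} else {}) \<union>
    ((#) Up ` (if u = 0 then {} else descents h (Suc k) (u - 1)) \<union>
     (#) Down ` (if k = 0 then {} else descents h (k - 1) u))"
proof (rule set_eqI)
  fix p
  show "p \<in> descents h k u \<longleftrightarrow> p \<in> 
    (if k = 0 \<and> u = 0 then {[]} else {}) \<union>
    ((#) Up ` (if u = 0 then {} else descents h (Suc k) (u - 1)) \<union>
     (#) Down ` (if k = 0 then {} else descents h (k - 1) u))"
    using assms by (cases "(h, k, p)" rule: admissible.cases) (auto simp: descents_def)
qed

lemma card_descents_step:
  assumes "k < h"
  shows "card (descents h k u) =
    (if k = 0 \<and> u = 0 then 1 else 0) +
    ((if u = 0 then 0 else card (descents h (Suc k) (u - 1))) +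
     (if k = 0 then 0 else card (descents h (k - 1) u)))"
proof -
  let ?A = "if k = 0 \<and> u = 0 then {[]} else {} :: step list set"
  let ?B = "(#) Up ` (if u = 0 then {} else descents h (Suc k) (u - 1))"
  let ?C = "(#) Down ` (if k = 0 then {} else descents h (k - 1) u)"
  have "card (?A \<union> (?B \<union> ?C)) = card ?A + card (?B \<union> ?C)"
    by (rule card_Un_disjoint) (auto simp: finite_descents)
  also have "card (?B \<union> ?C) = card ?B + card ?C"
    by (rule card_Un_disjoint) (auto simp: finite_descents)
  finally show ?thesis
    unfolding descents_step[OF assms, of u] by (simp add: card_image)
qed

lemma descent_gf_step:
  assumes "k < h"
  shows "descent_gf h k = (if k = 0 then 1 else 0) + fps_X * descent_gf h (Suc k) +
    (if k = 0 then 0 else descent_gf h (k - 1))"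
  by (rule fps_ext) (simp add: descent_gf_def card_descents_step[OF assms])

text \<open>
From the ceiling a path has to go down; as an up step would complete the forbidden valley, and the
word cannot end at height \<open>h - 1 > 0\<close>, the next step goes down as well.
\<close>

lemma descents_top:
  assumes "h \<ge> 2"
  shows "descents h h u = (\<lambda>p. Down # Down # p) ` descents h (h - 2) u"
proof (rule set_eqI)
  fix p
  have "p \<in> descents h h u \<longleftrightarrow> (\<exists>q. p = Down # Down # q \<and> q \<in> descents h (h - 2) u)"
    using assms
  proof (cases "(h, h, p)" rule: admissible.cases)
    case (3 h' k q)
    with assms show ?thesis
      by (cases "(h, h - 1, q)" rule: admissible.cases) (auto simp: descents_def numeral_2_eq_2)
  qed (use assms in \<open>auto simp: descents_def\<close>)
  then show "p \<in> descents h h u \<longleftrightarrow> p \<in> (\<lambda>p. Down # Down # p) ` descents h (h - 2) u"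
    by blast
qed

lemma descent_gf_top:
  assumes "h \<ge> 2"
  shows "descent_gf h h = descent_gf h (h - 2)"
  by (rule fps_ext) (simp add: descent_gf_def descents_top[OF assms] card_image inj_on_def)

text \<open>
These are the denominators of the finite continued fraction that expresses \<open>G\<^sub>0\<close>. The initial value
\<open>1 + x\<close>, in place of the value 1 for the strip without the valley condition, comes from
\<open>G\<^bsub>h-1\<^esub> = x G\<^sub>h + G\<^bsub>h-2\<^esub> = (1 + x) G\<^bsub>h-2\<^esub>\<close>.
\<close>

fun continuant :: "nat \<Rightarrow> real fps" where
  "continuant 0 = 1 + fps_X"
| "continuant (Suc 0) = 1"
| "continuant (Suc (Suc i)) = continuant (Suc i) - fps_X * continuant i"

text \<open>
Gaussian elimination from the ceiling: multiplying \<open>G\<^bsub>k+1\<^esub> = x G\<^bsub>k+2\<^esub> + G\<^sub>k\<close> by \<open>A\<^bsub>i+1\<^esub>\<close> and replacing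
\<open>A\<^bsub>i+1\<^esub> G\<^bsub>k+2\<^esub>\<close> by \<open>A\<^sub>i G\<^bsub>k+1\<^esub>\<close> eliminates \<open>G\<^bsub>k+2\<^esub>\<close>; the coefficient \<open>A\<^bsub>i+1\<^esub> - x A\<^sub>i\<close> of
\<open>G\<^bsub>k+1\<^esub>\<close> is \<open>A\<^bsub>i+2\<^esub>\<close>.
\<close>

lemma continuant_descent_gf:
  assumes "Suc (Suc i) \<le> h"
  shows "continuant (Suc i) * descent_gf h (h - Suc i) = continuant i * descent_gf h (h - Suc (Suc i))"
  using assms
proof (induction i)
  case 0
  then have "descent_gf h (h - 1) = fps_X * descent_gf h h + descent_gf h (h - 2)"
    using descent_gf_step[of "h - 1" h] by (simp add: numeral_2_eq_2)
  with 0 show ?case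
    using descent_gf_top[of h] by (simp add: numeral_2_eq_2 algebra_simps)
next
  case (Suc i)
  define k where "k = h - Suc (Suc (Suc i))"
  have h: "h - Suc i = Suc (Suc k)" "h - Suc (Suc i) = Suc k"
    using Suc.prems by (auto simp: k_def)
  have "descent_gf h (Suc k) = fps_X * descent_gf h (Suc (Suc k)) + descent_gf h k"
    using descent_gf_step[of "Suc k" h] Suc.prems h by simp
  moreover have "continuant (Suc i) * descent_gf h (Suc (Suc k)) = continuant i * descent_gf h (Suc k)"
    using Suc h by simp
  ultimately have "continuant (Suc i) * descent_gf h (Suc k) =
      fps_X * (continuant i * descent_gf h (Suc k)) + continuant (Suc i) * descent_gf h k"
    by (metis distrib_left mult.left_commute)
  then show ?case
    unfolding h k_def[symmetric] by (simp add: algebra_simps)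
qed

text \<open>
The elimination ends at the axis, where the equation \<open>G\<^sub>0 = 1 + x G\<^sub>1\<close> has no lower neighbour; its
constant term 1 (the empty word) leaves \<open>A\<^bsub>h-1\<^esub>\<close> on the right-hand side.
\<close>

lemma continuant_dyck_gf:
  assumes "h \<ge> 2"
  shows "continuant h * descent_gf h 0 = continuant (h - 1)"
proof -
  define i where "i = h - 2"
  have h: "h = Suc (Suc i)"
    using assms by (simp add: i_def)
  have "continuant (Suc i) * descent_gf h (Suc 0) = continuant i * descent_gf h 0"
    using continuant_descent_gf[of i h] h by simp
  moreover have "descent_gf h 0 = 1 + fps_X * descent_gf h (Suc 0)"
    using descent_gf_step[of 0 h] h by simp
  ultimately have "continuant (Suc i) * descent_gf h 0 =
      continuant (Suc i) + fps_X * (continuant i * descent_gf h 0)"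
    by (simp add: distrib_left mult.left_commute)
  then show ?thesis
    by (simp add: h left_diff_distrib mult.assoc)
qed

section \<open>Coefficients of the denominators\<close>

definition binomial_weight :: "nat \<Rightarrow> nat \<Rightarrow> real" where
  "binomial_weight i j = (3 * real j - real i - 2) / real j *
     real (binom (int i - int j + 1) (int j - 1))"

lemma binom_of_nat [simp]: "binom (int a) (int b) = a choose b"
  by (simp add: binom_def)

lemma binomial_weight_1: "binomial_weight i (Suc 0) = 1 - real i"
  by (simp add: binomial_weight_def binom_def)

lemma binomial_weight_eq_0:
  assumes "i + 2 < 2 * j"
  shows "binomial_weight i j = 0"
  using assms by (auto simp: binomial_weight_def binom_def)

text \<open>
All three binomial coefficients reduce to \<open>a\<close> over \<open>m\<close> and \<open>a\<close> over \<open>m + 1\<close> with \<open>a = i - m\<close>, by Pascal's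
rule; their ratio is \<open>(m + 1) : (a - m)\<close>, so the claim becomes a polynomial identity in \<open>a\<close> and \<open>m\<close>.
If \<open>i < m\<close>, all terms vanish; for \<open>i = m - 1\<close> this uses that the binomial coefficient is 0 for a
negative upper index.
\<close>

lemma binomial_weight_rec:
  "binomial_weight (Suc (Suc i)) (Suc (Suc m)) =
     binomial_weight (Suc i) (Suc (Suc m)) + binomial_weight i (Suc m)"
proof (cases "m \<le> i")
  case True
  define a where "a = i - m"
  have i: "i = a + m" using True by (simp add: a_def)
  have binoms: "binom (int (Suc (Suc i)) - int (Suc (Suc m)) + 1) (int (Suc (Suc m)) - 1) =
      Suc a choose Suc m"
    "binom (int (Suc i) - int (Suc (Suc m)) + 1) (int (Suc (Suc m)) - 1) = a choose Suc m"
    "binom (int i - int (Suc m) + 1) (int (Suc m) - 1) = a choose m"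
    by (simp_all add: i add.commute flip: binom_of_nat)
  have absorb: "(real m + 1) * real (a choose Suc m) = (real a - real m) * real (a choose m)"
  proof (cases "m \<le> a")
    case True
    have "Suc m * (a choose Suc m) = (a - m) * (a choose m)"
      using binomial_absorption[of m a] binomial_absorb_comp[of a m] by (rule trans[OF _ sym])
    then have "real (Suc m * (a choose Suc m)) = real ((a - m) * (a choose m))"
      by (rule arg_cong)
    then show ?thesis
      using True by (simp add: of_nat_diff algebra_simps)
  qed (simp add: binomial_eq_0)
  \<comment> \<open>The common factor of the two coefficients makes every term polynomial in \<open>a\<close> and \<open>m\<close>.\<close>
  define t where "t = real (a choose m) / (real m + 1)"
  have C: "real (a choose m) = (real m + 1) * t" "real (a choose Suc m) = (real a - real m) * t"
    using absorb by (simp_all add: t_def field_simps)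
  have "binomial_weight i (Suc m) = (2 * real m + 1 - real a) * t"
    unfolding binomial_weight_def binoms C
    by (simp add: i divide_simps) (simp add: algebra_simps)
  moreover have "binomial_weight (Suc (Suc i)) (Suc (Suc m)) =
      (2 * real m + 2 - real a) / (real m + 2) * ((real a + 1) * t)"
    unfolding binomial_weight_def binoms binomial_Suc_Suc of_nat_add C
    by (simp add: i algebra_simps)
  moreover have "binomial_weight (Suc i) (Suc (Suc m)) =
      (2 * real m + 3 - real a) / (real m + 2) * ((real a - real m) * t)"
    unfolding binomial_weight_def binoms C by (simp add: i algebra_simps)
  moreover have "(2 * real m + 2 - real a) / (real m + 2) * ((real a + 1) * t) =
      (2 * real m + 3 - real a) / (real m + 2) * ((real a - real m) * t) +
      (2 * real m + 1 - real a) * t"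
    by (simp add: divide_simps) (simp add: algebra_simps)
  ultimately show ?thesis
    by simp
next
  case False
  then show ?thesis
    by (simp add: binomial_weight_eq_0)
qed

lemma continuant_nth_0: "fps_nth (continuant i) 0 = 1"
  by (induction i rule: continuant.induct) auto

lemma continuant_nth:
  assumes "j \<ge> 1"
  shows "fps_nth (continuant i) j = - ((-1) ^ j * binomial_weight i j)"
  using assms
proof (induction i arbitrary: j rule: continuant.induct)
  case 1
  then show ?case
    by (cases "j = 1") (auto simp: binomial_weight_1 binomial_weight_eq_0)
next
  case 2
  then show ?case
    by (cases "j = 1") (auto simp: binomial_weight_1 binomial_weight_eq_0)
next
  case (3 i)
  show ?case
  proof (cases "j = 1")
    case True
    then show ?thesis
      using 3 by (simp add: binomial_weight_1 continuant_nth_0)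
  next
    case False
    define m where "m = j - 2"
    have "j = Suc (Suc m)"
      using False 3 by (simp add: m_def)
    then show ?thesis
      using 3 by (simp add: binomial_weight_rec algebra_simps)
  qed
qed

section \<open>The recurrence for restricted Dyck paths\<close>

theorem mainTheorem3:
  fixes h :: nat
  assumes "h \<ge> 2"
  shows "dyck_num h 0 = 1 \<and>
    (\<forall>n::nat. n \<ge> 1 \<longrightarrow>
      real (dyck_num h (int n)) =
        (\<Sum>j = 1..nat \<lceil>(real h + 1) / 2\<rceil>.
            real (dyck_num h (int n - int j)) * ((3 * real j - real h - 2) / real j)
              * real (binom (int h - int j + 1) (int j - 1)) * (-1) ^ j)
        - (3 * real n - real h - 1) / real n
            * real (binom (int h - int n) (int n - 1)) * (-1) ^ n)"
proof (intro conjI allI impI)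
  have dyck: "real (dyck_num h (int u)) = fps_nth (descent_gf h 0) u" for u
    by (simp add: dyck_num_def restricted_dyck_paths_eq descent_gf_def)
  note gf = continuant_dyck_gf[OF assms]
  have "fps_nth (descent_gf h 0) 0 = 1"
    using arg_cong[OF gf, of "\<lambda>f. fps_nth f 0"] by (simp add: continuant_nth_0)
  then show "dyck_num h 0 = 1"
    using dyck[of 0] by simp
  fix n :: nat
  assume n: "n \<ge> 1"
  define J where "J = nat \<lceil>(real h + 1) / 2\<rceil>"
  define t where "t j = real (dyck_num h (int n - int j)) * ((-1) ^ j * binomial_weight h j)" for j
  have "fps_nth (continuant (h - 1)) n = 
      (\<Sum>j = 0..n. fps_nth (continuant h) j * fps_nth (descent_gf h 0) (n - j))"
    using gf by (metis fps_mult_nth)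
  also have "\<dots> = fps_nth (descent_gf h 0) n +
      (\<Sum>j = 1..n. fps_nth (continuant h) j * fps_nth (descent_gf h 0) (n - j))"
    by (simp add: sum.atLeast_Suc_atMost continuant_nth_0)
  also have "(\<Sum>j = 1..n. fps_nth (continuant h) j * fps_nth (descent_gf h 0) (n - j)) = 
      (\<Sum>j = 1..n. - t j)"
    by (rule sum.cong) (auto simp: t_def continuant_nth of_nat_diff simp flip: dyck)
  also have "(\<Sum>j = 1..n. - t j) = - (\<Sum>j = 1..n. t j)"
    by (simp add: sum_negf)
  \<comment> \<open>Terms with \<open>j > n\<close> vanish since \<open>dyck_num\<close> is 0 at negative arguments, those with
     \<open>j > J\<close> since \<open>A\<^sub>h\<close> has degree at most \<open>J\<close>.\<close>
  also have "(\<Sum>j = 1..n. t j) = (\<Sum>j = 1..max n J. t j)"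
    by (rule sum.mono_neutral_left) (auto simp: t_def dyck_num_def)
  also have "\<dots> = (\<Sum>j = 1..J. t j)"
  proof (rule sum.mono_neutral_right)
    have "t j = 0" if "J < j" for j
    proof -
      have "(real h + 1) / 2 \<le> real J"
        unfolding J_def by linarith
      moreover have "real J + 1 \<le> real j"
        using that by linarith
      ultimately have "real (h + 2) < real (2 * j)"
        by simp
      then have "h + 2 < 2 * j"
        by (simp only: of_nat_less_iff)
      then show ?thesis
        by (simp add: t_def binomial_weight_eq_0)
    qed
    then show "\<forall>j\<in>{1..max n J} - {1..J}. t j = 0"
      by auto
  qed auto
  finally have "fps_nth (descent_gf h 0) n = (\<Sum>j = 1..J. t j) + fps_nth (continuant (h - 1)) n"
    by simp
  moreover have "fps_nth (continuant (h - 1)) n = 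
     - ((3 * real n - real h - 1) / real n * real (binom (int h - int n) (int n - 1)) * (-1) ^ n)"
    using n assms by (simp add: continuant_nth binomial_weight_def of_nat_diff)
  ultimately show "real (dyck_num h (int n)) =
        (\<Sum>j = 1..nat \<lceil>(real h + 1) / 2\<rceil>.
            real (dyck_num h (int n - int j)) * ((3 * real j - real h - 2) / real j)
              * real (binom (int h - int j + 1) (int j - 1)) * (-1) ^ j)
        - (3 * real n - real h - 1) / real n
            * real (binom (int h - int n) (int n - 1)) * (-1) ^ n"
    by (simp add: dyck J_def t_def binomial_weight_def mult_ac)
qed

end
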